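(* Let $C(A)$ be a simplicial cone, i.e. $A\in\mathbb{Z}^{n\times n}$ is invertible, let $\Delta=\Delta(A)=|\det A|$, and let $h$ be a Hilbert basis element of $C(A)$ with respect to $\mathbb{Z}^n$. Then $\mathcal{H}_{R(A),\mathbb{Z}^n}(C(A))\le 1$. Furthermore, $h$ lies in the (relative) interior of a $k$-dimensional face of $C(A)$ with $k\le\Delta$.
   Context: Notation: $[n]=\{1,\dots,n\}$; $A_{I,\cdot}$ is the submatrix of $A$ with rows indexed by $I$, and $A_{I,J}$ the submatrix with rows in $I$ and columns in $J$. For an $(n-1)\times n$ integer matrix $M$, $\gcd(M)$ is the gcd of its $(n-1)\times(n-1)$ minors. $C(A):=\{x\in\mathbb{R}^n: Ax\ge 0\}$. An extreme ray is a 1-dimensional face. Hilbert basis: a nonzero $h\in C(A)\cap\mathbb{Z}^n$ is a Hilbert basis element of $C(A)$ with respect to $\mathbb{Z}^n$ if for all $z^1,z^2\in C(A)\cap\mathbb{Z}^n$ with $h=z^1+z^2$ we have $z^1=0$ or $z^2=0$. Normalized generators: for each extreme ray of $C(A)$, consider all $I\subseteq[n]$ with $|I|=n-1$, $\operatorname{rank}(A_{I,\cdot})=n-1$ and $A_{I,\cdot}r=0$ for $r$ on the ray; choose such an $I$ with $\gcd(A_{I,\cdot})$ maximal (for invertible $A\in\mathbb{Z}^{n\times n}$ there is exactly one such $I$). The normalized generator of the ray is the vector $r$ on the ray with $r_i=(-1)^i\det A_{I,[n]\setminus\{i\}}$ for $i=1,\dots,n$, up to a global sign chosen so that $r\in C(A)$.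 $R(A)$ is the set of normalized generators. Height: $\mathcal{H}_{R(A),\mathbb{Z}^n}(h)=\min\{\sum_{r\in R(A)}\lambda_r:\ \sum_{r\in R(A)}\lambda_r r=h,\ \lambda_r\ge 0\}$, and $\mathcal{H}_{R(A),\mathbb{Z}^n}(C(A))$ is the maximum of $\mathcal{H}_{R(A),\mathbb{Z}^n}(h)$ over all Hilbert basis elements $h$ of $C(A)$ with respect to $\mathbb{Z}^n$. *)

theory Defs
  imports "HOL-Analysis.Analysis" "Jordan_Normal_Form.Determinant"
begin

no_notation Matrix.vec_index (infixl "$" 100)
hide_const (open) Determinant.det Matrix.mat Matrix.row

text \<open>
  A finite linearly ordered type \<open>'n\<close> plays the role of \<open>[n] = {1,...,n}\<close>; the order is needed to
  write down minors and the signs \<open>(-1)\<^sup>i\<close>.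
\<close>

abbreviation real_matrix :: "int^'n^'m \<Rightarrow> real^'n^'m" where
  "real_matrix \<equiv> map_matrix real_of_int"

definition abs_det :: "int^'n^'n \<Rightarrow> int" where
  "abs_det A = \<bar>det A\<bar>"

definition polyhedral_cone :: "int^'n^'n \<Rightarrow> (real^'n) set" where
  "polyhedral_cone A = {x. 0 \<le> real_matrix A *v x}"

definition integer_lattice :: "(real^'n) set" where
  "integer_lattice = {x. \<forall>i. x $ i \<in> \<int>}"

definition hilbert_basis_elements :: "int^'n^'n \<Rightarrow> (real^'n) set" where
  "hilbert_basis_elements A =
    {h \<in> polyhedral_cone A \<inter> integer_lattice. h \<noteq> 0 \<and>
      (\<forall>z1 \<in> polyhedral_cone A \<inter> integer_lattice. \<forall>z2 \<in> polyhedral_cone A \<inter> integer_lattice.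
        h = z1 + z2 \<longrightarrow> z1 = 0 \<or> z2 = 0)}"

text \<open>
  Determinant of the submatrix \<open>A\<^bsub>I,J\<^esub>\<close> for \<open>card I = card J\<close>, rows and columns being kept in their
  original order.
\<close>
definition minor :: "int^'n::{finite,linorder}^'n::{finite,linorder} \<Rightarrow> 'n set \<Rightarrow> 'n set \<Rightarrow> int" where
  "minor A I J = Determinant.det (Matrix.mat (card I) (card J)
     (\<lambda>(a, b). A $ (sorted_list_of_set I ! a) $ (sorted_list_of_set J ! b)))"

text \<open>
  For \<open>card I = n - 1\<close>, the column sets of the maximal minors of \<open>A\<^bsub>I,.\<^esub>\<close> are the complements of
  singletons.
\<close>
definition gcd_minors :: "int^'n::{finite,linorder}^'n::{finite,linorder} \<Rightarrow> 'n set \<Rightarrow> int" where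
  "gcd_minors A I = Gcd (range (\<lambda>i. minor A I (- {i})))"

definition extreme_ray :: "int^'n^'n \<Rightarrow> (real^'n) set \<Rightarrow> bool" where
  "extreme_ray A F \<longleftrightarrow> F face_of polyhedral_cone A \<and> aff_dim F = 1"

definition defines_ray :: "int^'n^'n \<Rightarrow> (real^'n) set \<Rightarrow> 'n set \<Rightarrow> bool" where
  "defines_ray A F I \<longleftrightarrow>
     card I = CARD('n) - 1 \<and>
     dim ((\<lambda>i. row i (real_matrix A)) ` I) = CARD('n) - 1 \<and>
     (\<forall>r\<in>F. \<forall>i\<in>I. (real_matrix A *v r) $ i = 0)"

text \<open>\<open>card {..i}\<close> is the position of \<open>i\<close> in \<open>[n]\<close>, counted from 1.\<close>
definition signed_minors :: "int^'n::{finite,linorder}^'n::{finite,linorder} \<Rightarrow> 'n set \<Rightarrow> real^'n::{finite,linorder}" where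
  "signed_minors A I = (\<chi> i. (-1) ^ card {..i} * real_of_int (minor A I (- {i})))"

text \<open>
  The choice of \<open>I\<close> is immaterial: two sets \<open>I\<close> attaining the maximal gcd yield vectors on the same
  ray with the same gcd of their entries.
\<close>
definition normalized_generators :: "int^'n::{finite,linorder}^'n::{finite,linorder} \<Rightarrow> (real^'n::{finite,linorder}) set" where
  "normalized_generators A =
    {r. \<exists>F I. extreme_ray A F \<and> defines_ray A F I \<and>
          (\<forall>I'. defines_ray A F I' \<longrightarrow> gcd_minors A I' \<le> gcd_minors A I) \<and>
          r \<in> F \<and> (r = signed_minors A I \<or> r = - signed_minors A I)}"

definition height :: "(real^'n) set \<Rightarrow> real^'n \<Rightarrow> real" where
  "height R h = (LEAST s. \<exists>c.
     (\<forall>r\<in>R. 0 \<le> c r) \<and> (\<Sum>r\<in>R. c r *\<^sub>R r) = h \<and> s = (\<Sum>r\<in>R. c r))"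

definition cone_height :: "int^'n::{finite,linorder}^'n::{finite,linorder} \<Rightarrow> real" where
  "cone_height A =
     (GREATEST s. s \<in> height (normalized_generators A) ` hilbert_basis_elements A)"

end

theory Submission
  imports Defs
begin

text \<open>
  The proof works in slack coordinates \<open>y = A x\<close>. They turn \<open>C(A)\<close> into the nonnegative orthant and
  \<open>\<int>\<^sup>n\<close> into the lattice \<open>L = A \<int>\<^sup>n\<close>. Put \<open>\<Delta> = \<bar>det A\<bar>\<close>.

  \<^item> The faces are the coordinate faces of the orthant, so \<open>h\<close> lies in the relative interior of a
    face whose dimension is the number of nonzero slacks of \<open>h\<close>. The slacks are nonnegative
    integers, so this number is at most \<open>\<Sum>i. (A h)\<^sub>i\<close>.
  \<^item> The signed minors of \<open>A\<close> without row \<open>j\<close> form, up to sign, the \<open>j\<close>-th column of the adjugate of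
    \<open>A\<close>. Hence the normalized generators are the vectors with slacks \<open>\<Delta> e\<^sub>j\<close>
    (\<open>normalized_generators_eq\<close>). They form a basis, so the combination that yields \<open>h\<close> is unique,
    and the height of \<open>h\<close> is \<open>(\<Sum>i. (A h)\<^sub>i) / \<Delta>\<close> (\<open>height_normalized_generators\<close>).

  Both claims therefore follow from \<open>\<Sum>i. (A h)\<^sub>i \<le> \<Delta>\<close>, for every Hilbert basis element \<open>h\<close>
  (\<open>hilbert_basis_element_slack_sum\<close>). This is the classical bound on the Davenport constant of a
  finite abelian group by its order, for the group \<open>\<int>\<^sup>n / L\<close>: if the slack vector were longer, climb
  from \<open>0\<close> towards it by unit steps. Among the first \<open>\<Delta> + 1\<close> vectors of the climb two agree modulo
  \<open>L\<close>; their difference is the slack vector of a lattice point that splits \<open>h\<close> properly.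

  The pigeonhole step needs \<open>\<int>\<^sup>n / L\<close> to have at most \<open>\<Delta>\<close> elements (\<open>lattice_pigeonhole\<close>). To see
  this, \<open>L\<close> is given a triangular basis \<open>B\<close>: division with remainder reduces every vector modulo \<open>L\<close>
  into a box with \<open>det B\<close> integer points, and \<open>det B\<close> divides \<open>det A\<close> because the columns of \<open>A\<close> lie
  in \<open>L\<close>.
\<close>

text \<open>The base names of these facts also denote facts about vectors of variable dimension.\<close>

lemmas cart_vec_eq_iff = Finite_Cartesian_Product.vec_eq_iff
lemmas cart_vec_le_iff = Finite_Cartesian_Product.less_eq_vec_def

section \<open>Minors and cofactors\<close>

definition nth_index :: "nat \<Rightarrow> 'n::{finite,linorder}" where
  "nth_index a = sorted_list_of_set UNIV ! a"

text \<open>Positions are counted from 0 here, as in the indexing of lists and of matrices of variable size.\<close>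

definition rank_of :: "'n::{finite,linorder} \<Rightarrow> nat" where
  "rank_of i = card {..<i}"

lemma nth_index_strict_mono:
  assumes "a < b" "b < CARD('n)"
  shows "(nth_index a :: 'n::{finite,linorder}) < nth_index b"
  unfolding nth_index_def
  using sorted_wrt_nth_less[OF strict_sorted_list_of_set[of "UNIV :: 'n set"], of a b] assms
  by simp

lemma bij_betw_nth_index: "bij_betw nth_index {..<CARD('n)} (UNIV :: 'n::{finite,linorder} set)"
  unfolding nth_index_def
  using bij_betw_nth[of "sorted_list_of_set (UNIV :: 'n set)"] by simp

lemma nth_index_cases:
  obtains a where "a < CARD('n)" "i = (nth_index a :: 'n::{finite,linorder})"
  using bij_betw_imp_surj_on[OF bij_betw_nth_index] by blast

lemma nth_index_less_iff:
  assumes "a < CARD('n)" "b < CARD('n)"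
  shows "(nth_index a :: 'n::{finite,linorder}) < nth_index b \<longleftrightarrow> a < b"
  using assms nth_index_strict_mono[of a b, where 'n='n] nth_index_strict_mono[of b a, where 'n='n]
  by (metis not_less_iff_gr_or_eq)

lemma rank_of_nth_index:
  assumes "a < CARD('n)"
  shows "rank_of (nth_index a :: 'n::{finite,linorder}) = a"
proof -
  have "{..<nth_index a :: 'n} = nth_index ` {..<a}"
  proof (intro equalityI subsetI)
    fix j :: 'n assume "j \<in> {..<nth_index a}"
    moreover obtain b where b: "b < CARD('n)" "j = nth_index b" by (rule nth_index_cases)
    ultimately show "j \<in> nth_index ` {..<a}"
      using nth_index_less_iff[OF b(1) assms] by auto
  next
    fix j :: 'n assume "j \<in> nth_index ` {..<a}"
    thus "j \<in> {..<nth_index a}" using nth_index_strict_mono assms by auto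
  qed
  moreover have "inj_on (nth_index :: nat \<Rightarrow> 'n) {..<a}"
    by (rule inj_on_subset[OF bij_betw_imp_inj_on[OF bij_betw_nth_index]]) (use assms in auto)
  ultimately show ?thesis by (simp add: rank_of_def card_image)
qed

lemma rank_of_less: "rank_of (i :: 'n::{finite,linorder}) < CARD('n)"
  unfolding rank_of_def by (rule psubset_card_mono) auto

lemma nth_index_rank_of [simp]: "nth_index (rank_of i) = i"
proof -
  obtain a where "a < CARD('a)" "i = nth_index a" by (rule nth_index_cases)
  thus ?thesis by (simp add: rank_of_nth_index)
qed

lemma rank_of_eq_iff: "rank_of i = rank_of j \<longleftrightarrow> i = j"
  by (metis nth_index_rank_of)

lemma card_Compl_singleton: "card (- {i :: 'n::finite}) = CARD('n) - 1"
  by (simp add: Compl_eq_Diff_UNIV card_Diff_singleton)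

text \<open>
  The index shift on the right is the one by which \<open>mat_delete\<close> removes a row or a column. It makes
  minors with respect to an abstract linear order into determinants of deleted matrices.
\<close>
lemma sorted_list_of_Compl_singleton:
  fixes i :: "'n::{finite,linorder}"
  assumes "a < CARD('n) - 1"
  shows "sorted_list_of_set (- {i}) ! a = nth_index (if a < rank_of i then a else Suc a)"
proof -
  define skip where "skip a = (if a < rank_of i then a else Suc a)" for a
  define xs where "xs = map (\<lambda>a. nth_index (skip a) :: 'n) [0..<CARD('n) - 1]"
  have skip_less: "skip a < CARD('n)" if "a < CARD('n) - 1" for a
    using that by (auto simp: skip_def)
  have sorted: "sorted_wrt (<) xs"
    unfolding sorted_wrt_iff_nth_less
  proof (intro allI impI)
    fix a b assume "a < b" "b < length xs"
    thus "xs ! a < xs ! b"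
      using nth_index_strict_mono[of "skip a" "skip b", where 'n='n] skip_less[of b]
      by (auto simp: xs_def skip_def split: if_splits)
  qed
  have "set xs \<subseteq> - {i}"
  proof
    fix x assume "x \<in> set xs"
    then obtain b where b: "b < CARD('n) - 1" "x = nth_index (skip b)" by (auto simp: xs_def)
    have "rank_of x \<noteq> rank_of i"
      unfolding b(2) rank_of_nth_index[OF skip_less[OF b(1)]] by (auto simp: skip_def)
    thus "x \<in> - {i}" by auto
  qed
  moreover have len: "length xs = card (- {i})"
    by (simp add: xs_def card_Compl_singleton)
  moreover have "card (set xs) = length xs"
    using sorted by (simp add: distinct_card strict_sorted_iff)
  ultimately have "set xs = - {i}" by (metis card_subset_eq finite)
  with sorted len have "sorted_list_of_set (- {i}) = xs"
    using sorted_list_of_set.sorted_key_list_of_set_unique by (metis finite sorted_list_of_set_unique)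
  thus ?thesis using assms by (simp add: xs_def skip_def)
qed

text \<open>
  A square matrix over an abstract index order, renumbered from 0, so that cofactors and the
  adjugate are available for it.
\<close>
definition jnf_matrix :: "'a^'n::{finite,linorder}^'n::{finite,linorder} \<Rightarrow> 'a mat" where
  "jnf_matrix A = Matrix.mat CARD('n) CARD('n) (\<lambda>(a, b). A $ nth_index a $ nth_index b)"

lemma jnf_matrix_carrier:
  "jnf_matrix (A :: 'a^'n::{finite,linorder}^'n::{finite,linorder}) \<in> carrier_mat CARD('n) CARD('n)"
  by (simp add: jnf_matrix_def)

text \<open>
  Conjugation with the enumeration of the index type is a sign-preserving bijection between the
  permutations of \<open>{0..<n}\<close> and those of the index type, so the two Leibniz sums agree term by term.
\<close>
lemma det_jnf_matrix:
  fixes A :: "'a::comm_ring_1^'n::{finite,linorder}^'n::{finite,linorder}"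
  shows "Determinant.det (jnf_matrix A) = det A"
proof -
  let ?I = "{0..<CARD('n)}"
  let ?\<phi> = "\<lambda>\<pi> x. if x \<in> (UNIV :: 'n set) then nth_index (\<pi> (inv_into ?I nth_index x)) else x"
  have bij: "bij_betw nth_index ?I (UNIV :: 'n set)"
    using bij_betw_nth_index by (simp add: atLeast0LessThan)
  have \<phi>: "?\<phi> \<pi> = map_permutation ?I nth_index \<pi>" for \<pi>
    using bij_betw_imp_surj_on[OF bij] by (auto simp: map_permutation_def fun_eq_iff)
  have term_eq: "of_int (sign \<pi>) * (\<Prod>a\<in>?I. jnf_matrix A $$ (a, \<pi> a))
      = of_int (sign (?\<phi> \<pi>)) * (\<Prod>i\<in>UNIV. A $ i $ ?\<phi> \<pi> i)" if "\<pi> permutes ?I" for \<pi>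
  proof -
    have "(\<Prod>i\<in>UNIV. A $ i $ ?\<phi> \<pi> i) = (\<Prod>a\<in>?I. A $ nth_index a $ ?\<phi> \<pi> (nth_index a))"
      by (rule prod.reindex_bij_betw[OF bij, symmetric])
    also have "\<dots> = (\<Prod>a\<in>?I. jnf_matrix A $$ (a, \<pi> a))"
    proof (rule prod.cong[OF refl])
      fix a assume a: "a \<in> ?I"
      moreover have "\<pi> a \<in> ?I" using that a by (simp only: permutes_in_image)
      ultimately show "A $ nth_index a $ ?\<phi> \<pi> (nth_index a) = jnf_matrix A $$ (a, \<pi> a)"
        using bij_betw_inv_into_left[OF bij a] by (simp add: jnf_matrix_def)
    qed
    moreover have "sign (?\<phi> \<pi>) = sign \<pi>"
      unfolding \<phi> by (rule sign_map_permutation[OF bij_betw_imp_inj_on[OF bij] that]) simp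
    ultimately show ?thesis by simp
  qed
  have "Determinant.det (jnf_matrix A)
      = (\<Sum>\<pi>\<in>{\<pi>. \<pi> permutes ?I}. of_int (sign \<pi>) * (\<Prod>a\<in>?I. jnf_matrix A $$ (a, \<pi> a)))"
    by (simp add: det_def'[OF jnf_matrix_carrier])
  also have "\<dots> = (\<Sum>\<pi>\<in>{\<pi>. \<pi> permutes ?I}. of_int (sign (?\<phi> \<pi>)) * (\<Prod>i\<in>UNIV. A $ i $ ?\<phi> \<pi> i))"
    by (rule sum.cong[OF refl]) (use term_eq in blast)
  also have "\<dots> = (\<Sum>p\<in>{p. p permutes (UNIV :: 'n set)}. of_int (sign p) * (\<Prod>i\<in>UNIV. A $ i $ p i))"
    by (rule sum.reindex_bij_betw[OF bij_betw_permutations[OF bij]])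
  also have "\<dots> = det A" by (simp add: Determinants.det_def)
  finally show ?thesis .
qed

lemma minor_Compl_singletons:
  fixes A :: "int^'n::{finite,linorder}^'n::{finite,linorder}"
  shows "minor A (- {j}) (- {i}) = Determinant.det (mat_delete (jnf_matrix A) (rank_of j) (rank_of i))"
proof -
  have "Matrix.mat (card (- {j})) (card (- {i}))
     (\<lambda>(a, b). A $ (sorted_list_of_set (- {j}) ! a) $ (sorted_list_of_set (- {i}) ! b))
     = mat_delete (jnf_matrix A) (rank_of j) (rank_of i)"
    by (rule eq_matI)
      (auto simp: mat_delete_def jnf_matrix_def card_Compl_singleton sorted_list_of_Compl_singleton)
  thus ?thesis by (simp add: minor_def)
qed

text \<open>The integer vector behind \<open>signed_minors\<close>, for use in lattice arguments.\<close>

definition int_signed_minors :: "int^'n::{finite,linorder}^'n::{finite,linorder} \<Rightarrow> 'n set \<Rightarrow> int^'n::{finite,linorder}"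
  where "int_signed_minors A I = (\<chi> i. (-1) ^ card {..i} * minor A I (- {i}))"

text \<open>
  The signed minors are the cofactors along row \<open>j\<close>, up to the common factor \<open>(-1) ^ card {..j}\<close>, that
  is, a column of the adjugate; the claim is column \<open>j\<close> of \<open>A * adj A = det A * 1\<close>.
\<close>
lemma mult_int_signed_minors:
  fixes A :: "int^'n::{finite,linorder}^'n::{finite,linorder}"
  shows "A *v int_signed_minors A (- {j}) = axis j ((-1) ^ card {..j} * det A)"
proof (rule cart_vec_eq_iff[THEN iffD2], rule allI)
  fix i :: 'n
  let ?B = "jnf_matrix A"
  have card_atMost: "card {..k} = Suc (rank_of k)" for k :: 'n
  proof -
    have "{..k} = insert k {..<k}" by auto
    thus ?thesis by (simp add: rank_of_def)
  qed
  have "(det A \<cdot>\<^sub>m 1\<^sub>m CARD('n)) $$ (rank_of i, rank_of j)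
      = (?B * adj_mat ?B) $$ (rank_of i, rank_of j)"
    using adj_mat(2)[OF jnf_matrix_carrier[of A]] by (simp add: det_jnf_matrix)
  also have "\<dots> = (\<Sum>b\<in>{0..<CARD('n)}. ?B $$ (rank_of i, b) * cofactor ?B (rank_of j) b)"
    using rank_of_less[of i] rank_of_less[of j] by (simp add: jnf_matrix_def scalar_prod_def adj_mat_def)
  also have "\<dots> = (\<Sum>b\<in>{0..<CARD('n)}. A $ i $ nth_index b * 
      ((-1) ^ (rank_of j + rank_of (nth_index b :: 'n)) * minor A (- {j}) (- {nth_index b})))"
    using rank_of_less[of i] 
    by (intro sum.cong refl) 
      (simp add: cofactor_def minor_Compl_singletons rank_of_nth_index, simp add: jnf_matrix_def)
  also have "\<dots> = (\<Sum>k\<in>UNIV. A $ i $ k * ((-1) ^ (rank_of j + rank_of k) * minor A (- {j}) (- {k})))"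
    by (rule sum.reindex_bij_betw) (use bij_betw_nth_index in \<open>simp add: atLeast0LessThan\<close>)
  also have "\<dots> = (\<Sum>k\<in>UNIV. (-1) ^ card {..j} * (A $ i $ k * int_signed_minors A (- {j}) $ k))"
    by (intro sum.cong refl) (simp add: int_signed_minors_def card_atMost power_add)
  also have "\<dots> = (-1) ^ card {..j} * (A *v int_signed_minors A (- {j})) $ i"
    by (simp add: matrix_vector_mult_def sum_distrib_left)
  finally have *: "(if i = j then det A else 0) = (-1) ^ card {..j} * (A *v int_signed_minors A (- {j})) $ i"
    using rank_of_less[of i] rank_of_less[of j] by (simp add: rank_of_eq_iff split: if_splits)
  have "(A *v int_signed_minors A (- {j})) $ i = (-1) ^ card {..j} * (if i = j then det A else 0)"
    unfolding * by (simp flip: mult.assoc power_add)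
  thus "(A *v int_signed_minors A (- {j})) $ i = axis j ((-1) ^ card {..j} * det A) $ i"
    by (simp add: axis_def)
qed

section \<open>The index of the lattice spanned by the columns\<close>

text \<open>
  A permutation other than the identity moves its least non-fixed index upwards, so its term in the
  Leibniz sum contains an entry above the diagonal.
\<close>
lemma det_lower_triangular_linorder:
  fixes B :: "'a::comm_ring_1^'n::{finite,linorder}^'n::{finite,linorder}"
  assumes tri: "\<And>i j. i < j \<Longrightarrow> B $ i $ j = 0"
  shows "det B = (\<Prod>i\<in>UNIV. B $ i $ i)"
proof -
  have zero: "of_int (sign p) * (\<Prod>i\<in>UNIV. B $ i $ p i) = 0"
    if p: "p permutes UNIV" and "p \<noteq> id" for p
  proof -
    let ?moved = "{i. p i \<noteq> i}"
    define i where "i = Min ?moved"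
    have "?moved \<noteq> {}" using \<open>p \<noteq> id\<close> by (auto simp: fun_eq_iff)
    hence moved: "p i \<noteq> i" and least: "\<And>k. p k \<noteq> k \<Longrightarrow> i \<le> k"
      unfolding i_def using Min_in[of ?moved] by auto
    have "p (p i) \<noteq> p i" using moved permutes_inj[OF p] by (metis injD)
    hence "i < p i" using least[of "p i"] moved by auto
    hence "B $ i $ p i = 0" by (rule tri)
    hence "(\<Prod>i\<in>UNIV. B $ i $ p i) = 0" by (intro prod_zero) auto
    thus ?thesis by simp
  qed
  have "det B = (\<Sum>p\<in>{id}. of_int (sign p) * (\<Prod>i\<in>UNIV. B $ i $ p i))"
    unfolding Determinants.det_def
    by (rule sum.mono_neutral_right) (auto simp: permutes_id intro: zero)
  thus ?thesis by simp
qed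

text \<open>
  Coordinates are reduced from the least one upwards: subtracting a multiple of column \<open>b\<close> changes
  only the coordinates from \<open>b\<close> on, so those already reduced stay as they are.
\<close>
lemma triangular_division_with_remainder:
  fixes B :: "int^'n::{finite,linorder}^'n::{finite,linorder}"
  assumes tri: "\<And>i j. i < j \<Longrightarrow> B $ i $ j = 0" and pos: "\<And>i. 0 < B $ i $ i"
  shows "\<exists>u. \<forall>i. 0 \<le> (v - B *v u) $ i \<and> (v - B *v u) $ i < B $ i $ i"
proof -
  have "\<exists>u. \<forall>i\<in>S. 0 \<le> (v - B *v u) $ i \<and> (v - B *v u) $ i < B $ i $ i" if "finite S" for S
    using that
  proof (induction S rule: finite_linorder_max_induct)
    case empty
    show ?case by simp
  next
    case (insert b S)
    then obtain u where u: "\<forall>i\<in>S. 0 \<le> (v - B *v u) $ i \<and> (v - B *v u) $ i < B $ i $ i"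
      by blast
    define q where "q = (v - B *v u) $ b div B $ b $ b"
    have step: "(v - B *v (u + axis b q)) $ i = (v - B *v u) $ i - B $ i $ b * q" for i
    proof -
      have "(B *v axis b q) $ i = B $ i $ b * q"
        by (simp add: matrix_vector_mult_def axis_def if_distrib[where f="\<lambda>x. _ * x"] cong: if_cong)
      thus ?thesis by (simp add: matrix_vector_right_distrib)
    qed
    have "(v - B *v (u + axis b q)) $ b = (v - B *v u) $ b mod B $ b $ b"
      unfolding step by (simp only: q_def minus_mult_div_eq_mod)
    moreover have "(v - B *v (u + axis b q)) $ i = (v - B *v u) $ i" if "i \<in> S" for i
      unfolding step using tri[of i b] insert.hyps(2) that by simp
    ultimately have "0 \<le> (v - B *v (u + axis b q)) $ i \<and> (v - B *v (u + axis b q)) $ i < B $ i $ i"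
      if "i \<in> insert b S" for i
      using u pos[of b] that by (metis insert_iff pos_mod_bound pos_mod_sign)
    thus ?case by blast
  qed
  from this[of UNIV] show ?thesis by simp
qed

text \<open>
  Column \<open>j\<close> of \<open>B\<close> is a lattice vector that vanishes before \<open>j\<close> and whose entry at \<open>j\<close> is positive and
  minimal; the adjugate provides the candidate \<open>\<bar>det A\<bar> e\<^sub>j\<close>. Minimality forces the remainder of a
  lattice vector on division by \<open>B\<close> to vanish, since its first nonzero entry would be smaller than a
  minimal one.
\<close>
lemma triangular_lattice_basis:
  fixes A :: "int^'n::{finite,linorder}^'n::{finite,linorder}"
  assumes det: "det A \<noteq> 0"
  shows "\<exists>B. (\<forall>i j. i < j \<longrightarrow> B $ i $ j = 0) \<and> (\<forall>i. 0 < B $ i $ i) \<and>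
    range ((*v) B) = range ((*v) A)"
proof -
  define starts_at where
    "starts_at j w \<longleftrightarrow> (\<forall>i<j. (A *v w) $ i = 0) \<and> 0 < (A *v w) $ j" for j :: 'n and w
  have "\<exists>w. starts_at j w" for j
  proof -
    \<comment> \<open>The factor that turns \<open>(-1) ^ card {..j} * det A\<close> into \<open>\<bar>det A\<bar>\<close>.\<close>
    define s :: int where "s = (-1) ^ card {..j} * sgn (det A)"
    have "A *v (s *s int_signed_minors A (- {j})) = s *s axis j ((-1) ^ card {..j} * det A)"
      unfolding mult_int_signed_minors[symmetric]
      by (simp add: cart_vec_eq_iff matrix_vector_mult_def sum_distrib_left mult.left_commute)
    also have "\<dots> = axis j \<bar>det A\<bar>"
    proof -
      have "s * ((-1) ^ card {..j} * det A) = (-1) ^ (card {..j} + card {..j}) * (det A * sgn (det A))"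
        by (simp add: s_def power_add mult.assoc mult.left_commute)
      thus ?thesis by (simp add: cart_vec_eq_iff axis_def abs_sgn)
    qed
    finally have "starts_at j (s *s int_signed_minors A (- {j}))"
      using det by (simp add: starts_at_def axis_def)
    thus ?thesis by blast
  qed
  hence "\<exists>w. starts_at j w \<and> (\<forall>w'. starts_at j w' \<longrightarrow> nat ((A *v w) $ j) \<le> nat ((A *v w') $ j))" for j
    by (metis ex_has_least_nat[of "starts_at j" _ "\<lambda>w. nat ((A *v w) $ j)"])
  hence "\<exists>w. \<forall>j. starts_at j (w j) \<and>
      (\<forall>w'. starts_at j w' \<longrightarrow> nat ((A *v w j) $ j) \<le> nat ((A *v w') $ j))"
    by (intro choice allI)
  then obtain w where w: "\<And>j. starts_at j (w j)"
    and least: "\<And>j w'. starts_at j w' \<Longrightarrow> nat ((A *v w j) $ j) \<le> nat ((A *v w') $ j)"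
    by blast
  define W where "W = (\<chi> i j. w j $ i)"
  define B where "B = A ** W"
  have B_entry: "B $ i $ j = (A *v w j) $ i" for i j
    by (simp add: B_def W_def matrix_matrix_mult_def matrix_vector_mult_def)
  have tri: "B $ i $ j = 0" if "i < j" for i j
    using w[of j] that by (simp add: B_entry starts_at_def)
  have pos: "0 < B $ i $ i" for i
    using w[of i] by (simp add: B_entry starts_at_def)
  have "range ((*v) B) \<subseteq> range ((*v) A)"
    by (auto simp: B_def matrix_vector_mul_assoc[symmetric])
  moreover have "A *v x \<in> range ((*v) B)" for x
  proof -
    have "\<exists>u. \<forall>i. 0 \<le> (A *v x - B *v u) $ i \<and> (A *v x - B *v u) $ i < B $ i $ i"
      by (rule triangular_division_with_remainder) (fact tri pos)+
    then obtain u where u: "\<And>i. 0 \<le> (A *v x - B *v u) $ i" "\<And>i. (A *v x - B *v u) $ i < B $ i $ i"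
      by metis
    define r where "r = A *v (x - W *v u)"
    have r: "r = A *v x - B *v u"
      unfolding r_def B_def by (simp only: matrix_vector_mult_diff_distrib matrix_vector_mul_assoc)
    have "r = 0"
    proof (rule ccontr)
      assume "r \<noteq> 0"
      define j where "j = Min {i. r $ i \<noteq> 0}"
      have "{i. r $ i \<noteq> 0} \<noteq> {}" using \<open>r \<noteq> 0\<close> by (simp add: cart_vec_eq_iff)
      hence nonzero: "r $ j \<noteq> 0" and first: "\<And>i. r $ i \<noteq> 0 \<Longrightarrow> j \<le> i"
        unfolding j_def using Min_in[of "{i. r $ i \<noteq> 0}"] by auto
      have "0 < r $ j" using u(1)[of j] nonzero by (simp only: r[symmetric])
      moreover have "r $ i = 0" if "i < j" for i using first[of i] that by (meson not_le)
      ultimately have "starts_at j (x - W *v u)" by (simp only: starts_at_def r_def[symmetric]) blast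
      from least[OF this] have "B $ j $ j \<le> r $ j"
        using \<open>0 < r $ j\<close> by (simp add: B_entry flip: r_def)
      thus False using u(2)[of j] by (simp only: r)
    qed
    hence "A *v x = B *v u" using r by (simp only: right_minus_eq)
    thus ?thesis by (metis rangeI)
  qed
  ultimately have "range ((*v) B) = range ((*v) A)" by blast
  with tri pos show ?thesis by blast
qed

lemma nat_prod_nonneg:
  assumes "\<And>i. i \<in> S \<Longrightarrow> 0 \<le> (d i :: int)"
  shows "nat (\<Prod>i\<in>S. d i) = (\<Prod>i\<in>S. nat (d i))"
  using assms by (induction S rule: infinite_finite_induct) (auto simp: nat_mult_distrib)

lemma card_box_nonneg_int:
  fixes d :: "'n::finite \<Rightarrow> int"
  assumes "\<And>i. 0 \<le> d i"
  shows "finite {x :: int^'n. \<forall>i. 0 \<le> x $ i \<and> x $ i < d i}"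
    and "card {x :: int^'n. \<forall>i. 0 \<le> x $ i \<and> x $ i < d i} = nat (\<Prod>i\<in>UNIV. d i)"
proof -
  let ?P = "PiE UNIV (\<lambda>i. {0..<d i})"
  have eq: "{x :: int^'n. \<forall>i. 0 \<le> x $ i \<and> x $ i < d i} = vec_lambda ` ?P"
  proof (intro equalityI subsetI)
    fix x :: "int^'n" assume "x \<in> {x. \<forall>i. 0 \<le> x $ i \<and> x $ i < d i}"
    hence "vec_nth x \<in> ?P" by auto
    thus "x \<in> vec_lambda ` ?P" by (metis image_eqI vec_nth_inverse)
  qed auto
  show "finite {x :: int^'n. \<forall>i. 0 \<le> x $ i \<and> x $ i < d i}"
    unfolding eq by (intro finite_imageI finite_PiE) auto
  have "inj_on (vec_lambda :: _ \<Rightarrow> int^'n) ?P"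
    by (rule inj_onI) (metis UNIV_I vec_lambda_inverse)
  hence "card {x :: int^'n. \<forall>i. 0 \<le> x $ i \<and> x $ i < d i} = (\<Prod>i\<in>UNIV. nat (d i))"
    unfolding eq by (simp add: card_image card_PiE)
  thus "card {x :: int^'n. \<forall>i. 0 \<le> x $ i \<and> x $ i < d i} = nat (\<Prod>i\<in>UNIV. d i)"
    using assms by (subst nat_prod_nonneg) auto
qed

text \<open>
  Reduction modulo a triangular basis \<open>B\<close> sends all vectors into a box with \<open>det B \<le> \<bar>det A\<bar>\<close> integer
  points, so two of the \<open>\<bar>det A\<bar> + 1\<close> vectors \<open>f 0, \<dots>, f \<bar>det A\<bar>\<close> have the same remainder. In other
  words, the lattice spanned by the columns of \<open>A\<close> has index at most \<open>\<bar>det A\<bar>\<close>.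
\<close>
lemma lattice_pigeonhole:
  fixes A :: "int^'n::{finite,linorder}^'n::{finite,linorder}" and f :: "nat \<Rightarrow> int^'n::{finite,linorder}"
  assumes det: "det A \<noteq> 0"
  obtains a b w where "a < b" "b \<le> nat \<bar>det A\<bar>" "f b - f a = A *v w"
proof -
  obtain B where B: "(\<forall>i j. i < j \<longrightarrow> B $ i $ j = 0) \<and> (\<forall>i. 0 < B $ i $ i) \<and>
      range ((*v) B) = range ((*v) A)"
    using triangular_lattice_basis[OF det] by (rule exE)
  hence tri: "B $ i $ j = 0" if "i < j" for i j using that by simp
  have pos: "0 < B $ i $ i" for i using B by simp
  have lattice: "range ((*v) B) = range ((*v) A)" using B by simp
  have detB: "det B = (\<Prod>i\<in>UNIV. B $ i $ i)" by (rule det_lower_triangular_linorder[OF tri])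
  have "\<exists>u. A *v axis j 1 = B *v u" for j
    using rangeI[of "(*v) A" "axis j 1"] unfolding lattice[symmetric] by blast
  then obtain u where u: "\<And>j. A *v axis j 1 = B *v u j" by metis
  \<comment> \<open>Each column of \<open>A\<close> lies in the lattice, hence is an integer combination of the columns of \<open>B\<close>.\<close>
  have "A = B ** (\<chi> i j. u j $ i)"
  proof -
    have "A $ i $ j = (B ** (\<chi> i j. u j $ i)) $ i $ j" for i j
    proof -
      have "A $ i $ j = (A *v axis j 1) $ i"
        by (simp add: matrix_vector_mult_def axis_def if_distrib[where f="\<lambda>x. _ * x"] cong: if_cong)
      thus ?thesis unfolding u by (simp add: matrix_matrix_mult_def matrix_vector_mult_def)
    qed
    thus ?thesis by (simp add: cart_vec_eq_iff)
  qed
  hence "det A = det B * det (\<chi> i j. u j $ i)" by (simp only: det_mul[symmetric])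
  hence "det B dvd det A" by (simp only: dvd_triv_left)
  hence "\<bar>det B\<bar> \<le> \<bar>det A\<bar>" by (rule dvd_imp_le_int[OF det])
  hence le: "det B \<le> \<bar>det A\<bar>" by linarith
  let ?box = "{x. \<forall>i. 0 \<le> x $ i \<and> x $ i < B $ i $ i}"
  have "\<exists>u. v - B *v u \<in> ?box" for v
    unfolding mem_Collect_eq by (rule triangular_division_with_remainder) (fact tri pos)+
  hence "\<exists>q. \<forall>v. v - B *v q v \<in> ?box" by (intro choice allI)
  then obtain q where "\<forall>v. v - B *v q v \<in> ?box" by (rule exE)
  hence q: "v - B *v q v \<in> ?box" for v by (rule spec)
  define res where "res v = v - B *v q v" for v
  have fin: "finite ?box" and card: "card ?box = nat (det B)"
    unfolding detB by (rule card_box_nonneg_int, rule less_imp_le, rule pos)+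
  have "\<not> inj_on (\<lambda>k. res (f k)) {0..nat \<bar>det A\<bar>}"
  proof
    assume "inj_on (\<lambda>k. res (f k)) {0..nat \<bar>det A\<bar>}"
    hence "card {0..nat \<bar>det A\<bar>} \<le> card ?box"
    proof (rule card_inj_on_le)
      show "(\<lambda>k. res (f k)) ` {0..nat \<bar>det A\<bar>} \<subseteq> ?box"
        unfolding res_def by (rule image_subsetI) (rule q)
    qed (rule fin)
    thus False using le by (simp add: card)
  qed
  then obtain a b where ab: "a < b" "b \<le> nat \<bar>det A\<bar>" "res (f a) = res (f b)"
    unfolding inj_on_def by (metis atLeastAtMost_iff linorder_neqE_nat)
  hence "f b - f a = B *v (q (f b) - q (f a))"
    unfolding res_def matrix_vector_mult_diff_distrib by (simp add: algebra_simps)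
  hence "f b - f a \<in> range ((*v) A)" unfolding lattice[symmetric] by (rule range_eqI)
  then obtain w where "f b - f a = A *v w" by (rule rangeE)
  with ab(1,2) show thesis by (rule that)
qed

section \<open>Hilbert basis elements have small slack vectors\<close>

definition real_vec :: "int^'n \<Rightarrow> real^'n" where
  "real_vec x = (\<chi> i. real_of_int (x $ i))"

lemma real_vec_nth [simp]: "real_vec x $ i = real_of_int (x $ i)"
  by (simp add: real_vec_def)

lemma real_matrix_mult_real_vec: "real_matrix A *v real_vec x = real_vec (A *v x)"
  by (simp add: cart_vec_eq_iff matrix_vector_mult_def)

lemma integer_lattice_eq_range: "integer_lattice = range real_vec"
proof (intro equalityI subsetI)
  fix x :: "real^'a" assume "x \<in> integer_lattice"
  hence "x = real_vec (\<chi> i. \<lfloor>x $ i\<rfloor>)"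
    by (auto simp: integer_lattice_def cart_vec_eq_iff)
  thus "x \<in> range real_vec" by blast
qed (auto simp: integer_lattice_def)

lemma det_real_matrix: "det (real_matrix A) = real_of_int (det A)"
  by (simp add: Determinants.det_def)

text \<open>
  A climb from \<open>0\<close> to \<open>y\<close> that raises one coordinate by 1 in each step; the minimum expresses that it
  stays at \<open>y\<close> once \<open>y\<close> is reached.
\<close>
lemma unit_step_chain:
  fixes y :: "int^'n"
  assumes nonneg: "\<And>i. 0 \<le> y $ i"
  shows "\<exists>f :: nat \<Rightarrow> int^'n. mono f \<and> (\<forall>k. (\<forall>i. 0 \<le> f k $ i \<and> f k $ i \<le> y $ i) \<and>
    (\<Sum>i\<in>UNIV. f k $ i) = min (int k) (\<Sum>i\<in>UNIV. y $ i))"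
proof -
  let ?P = "\<lambda>k z. (\<forall>i. 0 \<le> z $ i \<and> z $ i \<le> y $ i) \<and>
    (\<Sum>i\<in>UNIV. z $ i) = min (int k) (\<Sum>i\<in>UNIV. y $ i)"
  have "\<exists>f. \<forall>k. ?P k (f k) \<and> f k \<le> f (Suc k)"
  proof (rule dependent_nat_choice)
    show "\<exists>z. ?P 0 z"
      using nonneg by (intro exI[of _ 0]) (simp add: sum_nonneg)
    fix z k assume z: "?P k z"
    show "\<exists>z'. ?P (Suc k) z' \<and> z \<le> z'"
    proof (cases "int k < (\<Sum>i\<in>UNIV. y $ i)")
      case True
      hence "(\<Sum>i\<in>UNIV. z $ i) < (\<Sum>i\<in>UNIV. y $ i)" using z by simp
      then obtain j where j: "z $ j < y $ j" by (meson not_le sum_mono)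
      have "(\<Sum>i\<in>UNIV. (z + axis j 1) $ i) = int (Suc k)"
        using z True by (simp add: sum.distrib axis_def)
      thus ?thesis
        using True z j by (intro exI[of _ "z + axis j 1"]) (auto simp: axis_def cart_vec_le_iff)
    next
      case False
      thus ?thesis using z by (intro exI[of _ z]) auto
    qed
  qed
  then obtain f where f: "\<forall>k. ?P k (f k) \<and> f k \<le> f (Suc k)" by (rule exE)
  hence "mono f" by (simp add: mono_iff_le_Suc)
  with f show ?thesis by blast
qed

text \<open>
  If the slacks of \<open>h\<close> had sum greater than \<open>\<bar>det A\<bar>\<close>, two vectors among the first \<open>\<bar>det A\<bar> + 1\<close> of
  the climb to \<open>A h\<close> would differ by a lattice vector \<open>d\<close>. It satisfies \<open>0 \<le> d \<le> A h\<close>, and the sum of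
  its entries is positive but smaller than that of \<open>A h\<close>. So \<open>d\<close> is the slack vector of a proper
  summand of \<open>h\<close>.
\<close>
lemma hilbert_basis_element_slack_sum:
  fixes A :: "int^'n::{finite,linorder}^'n::{finite,linorder}"
  assumes det: "det A \<noteq> 0" and h: "h \<in> hilbert_basis_elements A"
  obtains x where "h = real_vec x" "\<forall>i. 0 \<le> (A *v x) $ i" "(\<Sum>i\<in>UNIV. (A *v x) $ i) \<le> abs_det A"
proof -
  have cone: "h \<in> polyhedral_cone A" and "h \<in> integer_lattice"
    using h by (auto simp: hilbert_basis_elements_def)
  then obtain x where x: "h = real_vec x" by (auto simp: integer_lattice_eq_range)
  define y where "y = A *v x"
  have y: "0 \<le> y $ i" for i
    using cone by (simp add: x polyhedral_cone_def real_matrix_mult_real_vec cart_vec_le_iff y_def)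
  have "(\<Sum>i\<in>UNIV. y $ i) \<le> \<bar>det A\<bar>"
  proof (rule ccontr)
    assume "\<not> ?thesis"
    hence large: "\<bar>det A\<bar> < (\<Sum>i\<in>UNIV. y $ i)" by simp
    obtain f where f: "mono f \<and> (\<forall>k. (\<forall>i. 0 \<le> f k $ i \<and> f k $ i \<le> y $ i) \<and>
        (\<Sum>i\<in>UNIV. f k $ i) = min (int k) (\<Sum>i\<in>UNIV. y $ i))"
      using unit_step_chain[OF y] by (rule exE)
    obtain a b w where ab: "a < b" "b \<le> nat \<bar>det A\<bar>" and w: "f b - f a = A *v w"
      by (rule lattice_pigeonhole[OF det])
    define d where "d = f b - f a"
    have d_nonneg: "0 \<le> d $ i" for i
      using f ab(1) by (simp add: d_def mono_def cart_vec_le_iff)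
    have d_le: "d $ i \<le> y $ i" for i
    proof -
      have "0 \<le> f a $ i" "f b $ i \<le> y $ i" using f by simp_all
      thus ?thesis by (simp add: d_def)
    qed
    have d_sum: "(\<Sum>i\<in>UNIV. d $ i) = int b - int a"
      using f ab large by (simp add: d_def sum_subtractf)
    define z where "z = real_vec w"
    have slack_z: "real_matrix A *v z = real_vec d"
      by (simp add: z_def real_matrix_mult_real_vec d_def w)
    have slack_diff: "real_matrix A *v (h - z) = real_vec (y - d)"
      by (simp add: matrix_vector_mult_diff_distrib slack_z x real_matrix_mult_real_vec y_def)
         (simp add: cart_vec_eq_iff)
    have "z \<in> polyhedral_cone A" "h - z \<in> polyhedral_cone A"
      using d_nonneg d_le by (simp_all add: polyhedral_cone_def slack_z slack_diff cart_vec_le_iff)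
    moreover have "z \<in> integer_lattice" "h - z \<in> integer_lattice"
      by (simp_all add: integer_lattice_def z_def x)
    moreover have "h = z + (h - z)" by simp
    ultimately have "z = 0 \<or> h - z = 0"
      using h unfolding hilbert_basis_elements_def by blast
    thus False
    proof
      assume "z = 0"
      hence "real_vec d = 0" using slack_z by simp
      hence "d = 0" by (simp add: cart_vec_eq_iff)
      thus False using d_sum ab(1) by simp
    next
      assume "h - z = 0"
      hence "real_vec (y - d) = 0" using slack_diff by simp
      hence "y = d" by (simp add: cart_vec_eq_iff)
      thus False using d_sum ab large by simp
    qed
  qed
  hence "(\<Sum>i\<in>UNIV. (A *v x) $ i) \<le> abs_det A" by (simp only: y_def abs_det_def)
  moreover have "\<forall>i. 0 \<le> (A *v x) $ i" using y by (simp add: y_def)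
  ultimately show thesis using x by (intro that)
qed

section \<open>Faces of a simplicial cone\<close>

definition slack_face :: "int^'n^'n \<Rightarrow> 'n set \<Rightarrow> (real^'n) set" where
  "slack_face A S = {x \<in> polyhedral_cone A. \<forall>i. i \<notin> S \<longrightarrow> (real_matrix A *v x) $ i = 0}"

lemma convex_polyhedral_cone: "convex (polyhedral_cone A)"
  by (rule convexI)
     (simp add: polyhedral_cone_def cart_vec_le_iff matrix_vector_right_distrib matrix_vector_mult_scaleR)

lemma slack_face_face_of: "slack_face A S face_of polyhedral_cone A"
  unfolding face_of_def
proof (intro conjI ballI impI)
  show "slack_face A S \<subseteq> polyhedral_cone A" by (auto simp: slack_face_def)
  show "convex (slack_face A S)"
    by (rule convexI)
       (auto simp: slack_face_def convexD[OF convex_polyhedral_cone]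
         matrix_vector_right_distrib matrix_vector_mult_scaleR)
  fix a b x
  assume cone: "a \<in> polyhedral_cone A" "b \<in> polyhedral_cone A"
    and x: "x \<in> slack_face A S" "x \<in> open_segment a b"
  then obtain u where u: "0 < u" "u < 1" "x = (1 - u) *\<^sub>R a + u *\<^sub>R b"
    by (auto simp: in_segment)
  have "(real_matrix A *v a) $ i = 0 \<and> (real_matrix A *v b) $ i = 0" if "i \<notin> S" for i
  proof -
    have "(1 - u) * (real_matrix A *v a) $ i + u * (real_matrix A *v b) $ i = 0"
      using x(1) that by (simp add: slack_face_def u(3) matrix_vector_right_distrib matrix_vector_mult_scaleR)
    moreover have "0 \<le> (real_matrix A *v a) $ i" "0 \<le> (real_matrix A *v b) $ i"
      using cone by (simp_all add: polyhedral_cone_def cart_vec_le_iff)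
    ultimately show ?thesis
      using u(1,2) by (simp add: add_nonneg_eq_0_iff)
  qed
  thus "a \<in> slack_face A S" "b \<in> slack_face A S" using cone by (auto simp: slack_face_def)
qed

lemma matrix_vector_mult_matrix_inv:
  assumes "invertible M"
  shows "M *v (matrix_inv M *v y) = (y :: real^'n)"
proof -
  have "M ** matrix_inv M = mat 1"
    unfolding matrix_inv_def using assms[unfolded invertible_def] by (rule someI2_ex) simp
  thus ?thesis by (simp add: matrix_vector_mul_assoc)
qed

lemma inj_invertible_matrix_vector_mult:
  fixes M :: "real^'n^'n"
  assumes "invertible M"
  shows "inj ((*v) M)"
  using assms invertible_def inj_matrix_vector_mult by blast

lemma dim_axis_image: "dim ((\<lambda>i. axis i (1::real)) ` (S :: 'n::finite set)) = card S"
proof -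
  have "independent ((\<lambda>i. axis i (1::real)) ` S)"
    by (rule independent_mono[OF independent_Basis]) (auto simp: axis_in_Basis_iff)
  moreover have "inj_on (\<lambda>i. axis i (1::real)) S" by (auto simp: inj_on_def axis_eq_axis)
  ultimately show ?thesis by (simp add: dim_eq_card_independent card_image)
qed

text \<open>
  The isomorphism \<open>x \<mapsto> A x\<close> maps the face onto a coordinate face of the orthant, which is spanned by
  the unit vectors that it contains.
\<close>
lemma aff_dim_slack_face:
  assumes inv: "invertible (real_matrix A)"
  shows "aff_dim (slack_face A S) = int (card S)"
proof -
  let ?M = "real_matrix A"
  let ?O = "{y :: real^'a. 0 \<le> y \<and> (\<forall>i. i \<notin> S \<longrightarrow> y $ i = 0)}"
  have "(*v) ?M ` slack_face A S = ?O"
  proof (intro equalityI subsetI)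
    fix y assume "y \<in> ?O"
    moreover have "y = ?M *v (matrix_inv ?M *v y)"
      by (simp add: matrix_vector_mult_matrix_inv[OF inv])
    ultimately show "y \<in> (*v) ?M ` slack_face A S"
      by (intro image_eqI[of _ _ "matrix_inv ?M *v y"])
         (auto simp: slack_face_def polyhedral_cone_def)
  qed (auto simp: slack_face_def polyhedral_cone_def)
  moreover have "aff_dim ((*v) ?M ` slack_face A S) = aff_dim (slack_face A S)"
    by (rule aff_dim_injective_linear_image)
       (simp_all add: inj_invertible_matrix_vector_mult[OF inv])
  moreover have "aff_dim ?O = int (dim ?O)"
    by (rule aff_dim_zero) (rule hull_inc, simp)
  moreover have "dim ?O = card S"
  proof -
    let ?B = "(\<lambda>i. axis i (1::real)) ` S"
    have "?O \<subseteq> span ?B"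
    proof
      fix y assume y: "y \<in> ?O"
      have "y = (\<Sum>i\<in>S. y $ i *\<^sub>R axis i 1)"
        using y by (simp add: cart_vec_eq_iff axis_def if_distrib[where f="\<lambda>x. _ * x"] cong: if_cong)
      also have "\<dots> \<in> span ?B" by (intro span_sum span_scale span_base) auto
      finally show "y \<in> span ?B" .
    qed
    moreover have "?B \<subseteq> ?O" by (auto simp: axis_def cart_vec_le_iff)
    ultimately have "dim ?O = dim ?B"
      by (intro order.antisym dim_mono dim_subset)
    thus ?thesis by (simp add: dim_axis_image)
  qed
  ultimately show ?thesis by simp
qed

text \<open>
  On the affine hull the slacks outside \<open>S\<close> vanish, so the only inequalities left are those indexed by
  \<open>S\<close>, and strict inequalities persist in a neighbourhood.
\<close>
lemma mem_rel_interior_slack_face: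
  fixes A :: "int^'n^'n"
  assumes x: "x \<in> slack_face A S" and pos: "\<And>i. i \<in> S \<Longrightarrow> 0 < (real_matrix A *v x) $ i"
  shows "x \<in> rel_interior (slack_face A S)"
  unfolding mem_rel_interior
proof (intro exI conjI)
  let ?T = "\<Inter>i\<in>S. {x. 0 < (real_matrix A *v x) $ i}"
  have cont: "continuous_on UNIV (\<lambda>x. (real_matrix A *v x) $ i)" for i
    by (intro continuous_on_component matrix_vector_mult_linear_continuous_on)
  show "open ?T"
    by (intro open_INT ballI open_Collect_less cont continuous_on_const) simp
  show "x \<in> ?T \<inter> slack_face A S" using x pos by simp
  let ?L = "{x. \<forall>i. i \<notin> S \<longrightarrow> (real_matrix A *v x) $ i = 0}"
  have "affine ?L"
    by (auto simp: affine_def matrix_vector_right_distrib matrix_vector_mult_scaleR)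
  hence "affine hull slack_face A S \<subseteq> ?L"
    by (intro hull_minimal) (auto simp: slack_face_def)
  moreover have "?T \<inter> ?L \<subseteq> slack_face A S"
  proof
    fix x assume x: "x \<in> ?T \<inter> ?L"
    have "0 \<le> (real_matrix A *v x) $ i" for i
      using x by (cases "i \<in> S") (auto simp: less_imp_le)
    thus "x \<in> slack_face A S" using x by (simp add: slack_face_def polyhedral_cone_def cart_vec_le_iff)
  qed
  ultimately show "?T \<inter> affine hull slack_face A S \<subseteq> slack_face A S" by blast
qed

section \<open>Normalized generators and heights\<close>

definition ray_generator :: "int^'n^'n \<Rightarrow> 'n \<Rightarrow> real^'n" where
  "ray_generator A j = matrix_inv (real_matrix A) *v axis j (real_of_int (abs_det A))"

lemma mult_ray_generator:
  assumes "invertible (real_matrix A)"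
  shows "real_matrix A *v ray_generator A j = axis j (real_of_int (abs_det A))"
  unfolding ray_generator_def by (rule matrix_vector_mult_matrix_inv[OF assms])

lemma det_nonzero:
  assumes "invertible (real_matrix A)"
  shows "det A \<noteq> 0"
  using assms invertible_det_nz[of "real_matrix A"] by (simp add: det_real_matrix)

lemma mult_signed_minors:
  fixes A :: "int^'n::{finite,linorder}^'n::{finite,linorder}"
  shows "real_matrix A *v signed_minors A (- {j}) = axis j (real_of_int ((-1) ^ card {..j} * det A))"
proof -
  have "signed_minors A (- {j}) = real_vec (int_signed_minors A (- {j}))"
    by (simp add: signed_minors_def int_signed_minors_def cart_vec_eq_iff)
  thus ?thesis
    by (simp only: real_matrix_mult_real_vec mult_int_signed_minors) (simp add: cart_vec_eq_iff axis_def)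
qed

text \<open>
  The slacks of a nonzero point on the \<open>j\<close>-th ray vanish exactly outside \<open>j\<close>, which leaves one candidate for
  the row set. It does define the ray, as the rows of an invertible matrix are independent.
\<close>
lemma defines_ray_slack_face_singleton:
  fixes A :: "int^'n::{finite,linorder}^'n::{finite,linorder}"
  assumes inv: "invertible (real_matrix A)"
  shows "defines_ray A (slack_face A {j}) I \<longleftrightarrow> I = - {j}"
proof
  assume I: "defines_ray A (slack_face A {j}) I"
  have "real_matrix A *v ray_generator A j = axis j (real_of_int (abs_det A))"
    by (rule mult_ray_generator[OF inv])
  hence "ray_generator A j \<in> slack_face A {j}" "(real_matrix A *v ray_generator A j) $ j \<noteq> 0"
    using det_nonzero[OF inv]
    by (auto simp: slack_face_def polyhedral_cone_def cart_vec_le_iff axis_def abs_det_def)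
  hence "j \<notin> I" using I by (auto simp: defines_ray_def)
  moreover have "card I = card (- {j})" using I by (simp add: defines_ray_def card_Compl_singleton)
  ultimately show "I = - {j}" by (intro card_subset_eq) auto
next
  assume I: "I = - {j}"
  let ?T = "transpose (real_matrix A)"
  have "invertible ?T" using inv by (simp add: invertible_det_nz)
  have "(\<lambda>i. row i (real_matrix A)) ` I = (*v) ?T ` (\<lambda>i. axis i 1) ` I"
    by (simp only: image_image matrix_vector_mult_basis column_transpose)
  also have "dim \<dots> = dim ((\<lambda>i. axis i (1::real)) ` I)"
    by (rule dim_image_eq)
       (simp_all only: matrix_vector_mul_linear
         inj_on_subset[OF inj_invertible_matrix_vector_mult[OF \<open>invertible ?T\<close>] subset_UNIV])
  finally show "defines_ray A (slack_face A {j}) I"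
    by (simp add: defines_ray_def I dim_axis_image card_Compl_singleton slack_face_def)
qed

lemma matrix_vector_mult_uminus: "M *v (- v) = - (M *v (v :: 'a::ring_1^'n))"
  by (simp add: cart_vec_eq_iff matrix_vector_mult_def sum_negf)

lemma axis_uminus: "axis j (- c) = - axis j (c :: 'a::group_add)"
  by (simp add: cart_vec_eq_iff axis_def)

text \<open>
  Up to sign, the signed minors have slack vector \<open>(det A) e\<^sub>j\<close>; membership in the cone selects the
  sign.
\<close>
lemma normalized_generators_eq:
  fixes A :: "int^'n::{finite,linorder}^'n::{finite,linorder}"
  assumes inv: "invertible (real_matrix A)"
  shows "normalized_generators A = range (ray_generator A)"
proof (intro equalityI subsetI)
  fix r assume "r \<in> normalized_generators A"
  then obtain F I where F: "extreme_ray A F" and I: "defines_ray A F I" and "r \<in> F"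
    and r: "r = signed_minors A I \<or> r = - signed_minors A I"
    by (auto simp: normalized_generators_def)
  have "card (- I) = 1"
  proof -
    have "card I + 1 = CARD('n)" using I by (simp add: defines_ray_def)
    thus ?thesis by (simp add: Compl_eq_Diff_UNIV card_Diff_subset)
  qed
  then obtain j where "- I = {j}" by (rule card_1_singletonE)
  hence "I = - {j}" by auto
  hence "\<exists>c. \<bar>c\<bar> = abs_det A \<and> real_matrix A *v r = axis j (real_of_int c)"
  proof -
    let ?c = "(-1) ^ card {..j} * det A"
    have "\<bar>?c\<bar> = abs_det A" "\<bar>- ?c\<bar> = abs_det A" by (simp_all add: abs_det_def abs_mult)
    moreover have "real_matrix A *v r = axis j (real_of_int ?c) \<or>
        real_matrix A *v r = axis j (real_of_int (- ?c))"
      using r unfolding \<open>I = - {j}\<close>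
      by (elim disjE; simp only: matrix_vector_mult_uminus mult_signed_minors of_int_minus axis_uminus simp_thms)
    ultimately show ?thesis by blast
  qed
  then obtain c where c: "\<bar>c\<bar> = abs_det A" "real_matrix A *v r = axis j (real_of_int c)" by blast
  have "r \<in> polyhedral_cone A"
    using F \<open>r \<in> F\<close> face_of_imp_subset by (auto simp: extreme_ray_def)
  hence "0 \<le> (real_matrix A *v r) $ j" by (simp add: polyhedral_cone_def cart_vec_le_iff)
  hence "c = abs_det A" using c by (simp add: axis_def)
  hence "real_matrix A *v r = real_matrix A *v ray_generator A j"
    using c(2) by (simp add: mult_ray_generator[OF inv])
  hence "r = ray_generator A j"
    by (rule injD[OF inj_invertible_matrix_vector_mult[OF inv]])
  thus "r \<in> range (ray_generator A)" by simp
next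
  fix r assume "r \<in> range (ray_generator A)"
  then obtain j where r: "r = ray_generator A j" by auto
  let ?F = "slack_face A {j}"
  have Ar: "real_matrix A *v r = axis j (real_of_int (abs_det A))"
    by (simp add: r mult_ray_generator[OF inv])
  have "extreme_ray A ?F"
    by (simp add: extreme_ray_def slack_face_face_of aff_dim_slack_face[OF inv])
  moreover have "r \<in> ?F"
    by (auto simp: slack_face_def polyhedral_cone_def Ar cart_vec_le_iff axis_def abs_det_def)
  moreover have "r = signed_minors A (- {j}) \<or> r = - signed_minors A (- {j})"
  proof -
    let ?s = "(-1) ^ card {..j} * det A"
    have "abs_det A = \<bar>?s\<bar>" by (simp add: abs_det_def abs_mult)
    hence "abs_det A = ?s \<or> abs_det A = - ?s" by linarith
    hence "real_matrix A *v r = real_matrix A *v signed_minors A (- {j}) \<or>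
        real_matrix A *v r = real_matrix A *v (- signed_minors A (- {j}))"
    proof
      assume "abs_det A = ?s"
      thus ?thesis unfolding Ar mult_signed_minors by simp
    next
      assume "abs_det A = - ?s"
      thus ?thesis unfolding Ar matrix_vector_mult_uminus mult_signed_minors axis_uminus[symmetric] by simp
    qed
    thus ?thesis using injD[OF inj_invertible_matrix_vector_mult[OF inv]] by blast
  qed
  ultimately show "r \<in> normalized_generators A"
    unfolding normalized_generators_def
    by (intro CollectI exI[of _ ?F] exI[of _ "- {j}"])
       (simp add: defines_ray_slack_face_singleton[OF inv])
qed

text \<open>
  The generators form a basis of the space, so the linear program that defines the height has a
  single feasible point: the coefficient of the \<open>j\<close>-th generator is \<open>(A h)\<^sub>j / \<bar>det A\<bar>\<close>.
\<close>
lemma height_normalized_generators: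
  fixes A :: "int^'n::{finite,linorder}^'n::{finite,linorder}"
  assumes inv: "invertible (real_matrix A)" and h: "h \<in> polyhedral_cone A"
  shows "height (normalized_generators A) h
    = (\<Sum>i\<in>UNIV. (real_matrix A *v h) $ i) / real_of_int (abs_det A)"
proof -
  let ?M = "real_matrix A" and ?g = "ray_generator A" and ?\<Delta> = "real_of_int (abs_det A)"
  have pos: "0 < ?\<Delta>" using det_nonzero[OF inv] by (simp add: abs_det_def)
  have g: "?M *v ?g j = axis j ?\<Delta>" for j by (rule mult_ray_generator[OF inv])
  have "inj ?g"
  proof (rule injI)
    fix i j assume "?g i = ?g j"
    hence "axis i ?\<Delta> = axis j ?\<Delta>" by (metis g)
    thus "i = j" using pos by (simp add: axis_eq_axis)
  qed
  hence reindex: "(\<Sum>r\<in>range ?g. f r) = (\<Sum>j\<in>UNIV. f (?g j))" for f :: "_ \<Rightarrow> 'b::comm_monoid_add"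
    by (simp add: sum.reindex)
  have combination_iff: "(\<Sum>r\<in>range ?g. c r *\<^sub>R r) = h \<longleftrightarrow> (\<forall>j. c (?g j) = (?M *v h) $ j / ?\<Delta>)" for c
  proof -
    have "(?M *v (\<Sum>j\<in>UNIV. c (?g j) *\<^sub>R ?g j)) $ i = c (?g i) * ?\<Delta>" for i
      by (simp add: linear_sum[OF matrix_vector_mul_linear] matrix_vector_mult_scaleR g axis_def
          if_distrib[where f="\<lambda>x. _ * x"] cong: if_cong)
    moreover have "(\<Sum>j\<in>UNIV. c (?g j) *\<^sub>R ?g j) = h \<longleftrightarrow> 
        ?M *v (\<Sum>j\<in>UNIV. c (?g j) *\<^sub>R ?g j) = ?M *v h"
      using injD[OF inj_invertible_matrix_vector_mult[OF inv]] by metis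
    ultimately show ?thesis
      unfolding reindex using pos by (simp add: cart_vec_eq_iff field_simps)
  qed
  define c where "c r = (?M *v h) $ (inv_into UNIV ?g r) / ?\<Delta>" for r
  have c: "c (?g j) = (?M *v h) $ j / ?\<Delta>" for j by (simp add: c_def inv_f_f[OF \<open>inj ?g\<close>])
  show ?thesis
    unfolding height_def normalized_generators_eq[OF inv]
  proof (rule Least_equality)
    show "\<exists>c. (\<forall>r\<in>range ?g. 0 \<le> c r) \<and> (\<Sum>r\<in>range ?g. c r *\<^sub>R r) = h \<and>
        (\<Sum>i\<in>UNIV. (?M *v h) $ i) / ?\<Delta> = (\<Sum>r\<in>range ?g. c r)"
    proof (intro exI[of _ c] conjI)
      show "\<forall>r\<in>range ?g. 0 \<le> c r"
        using h pos by (simp add: c_def polyhedral_cone_def cart_vec_le_iff)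
      show "(\<Sum>r\<in>range ?g. c r *\<^sub>R r) = h" by (simp only: combination_iff c) simp
      show "(\<Sum>i\<in>UNIV. (?M *v h) $ i) / ?\<Delta> = (\<Sum>r\<in>range ?g. c r)"
        by (simp add: reindex c sum_divide_distrib)
    qed
  next
    fix s assume "\<exists>c. (\<forall>r\<in>range ?g. 0 \<le> c r) \<and> (\<Sum>r\<in>range ?g. c r *\<^sub>R r) = h \<and>
        s = (\<Sum>r\<in>range ?g. c r)"
    then obtain c where c: "(\<Sum>r\<in>range ?g. c r *\<^sub>R r) = h" and s: "s = (\<Sum>r\<in>range ?g. c r)"
      by blast
    from c have "\<forall>j. c (?g j) = (?M *v h) $ j / ?\<Delta>" by (rule combination_iff[THEN iffD1])
    thus "(\<Sum>i\<in>UNIV. (?M *v h) $ i) / ?\<Delta> \<le> s"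
      by (simp add: s reindex sum_divide_distrib)
  qed
qed

text \<open>
  Besides bounding the heights by 1, this confines them to a finite set, so that their maximum
  exists.
\<close>
lemma height_hilbert_basis_element:
  fixes A :: "int^'n::{finite,linorder}^'n::{finite,linorder}"
  assumes inv: "invertible (real_matrix A)" and h: "h \<in> hilbert_basis_elements A"
  shows "height (normalized_generators A) h
    \<in> (\<lambda>m. real_of_int m / real_of_int (abs_det A)) ` {0..abs_det A}"
proof -
  obtain x where x: "h = real_vec x" "\<forall>i. 0 \<le> (A *v x) $ i" "(\<Sum>i\<in>UNIV. (A *v x) $ i) \<le> abs_det A"
    by (rule hilbert_basis_element_slack_sum[OF det_nonzero[OF inv] h])
  have "h \<in> polyhedral_cone A" using h by (simp add: hilbert_basis_elements_def)
  hence "height (normalized_generators A) h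
      = real_of_int (\<Sum>i\<in>UNIV. (A *v x) $ i) / real_of_int (abs_det A)"
    by (simp add: height_normalized_generators[OF inv] x(1) real_matrix_mult_real_vec)
  moreover have "(\<Sum>i\<in>UNIV. (A *v x) $ i) \<in> {0..abs_det A}" using x by (simp add: sum_nonneg)
  ultimately show ?thesis by blast
qed

theorem corollary1p7:
  fixes A :: "int^'n::{finite,linorder}^'n::{finite,linorder}" and h :: "real^'n::{finite,linorder}"
  assumes "invertible (real_matrix A)"
    and "h \<in> hilbert_basis_elements A"
  shows "cone_height A \<le> 1 \<and>
    (\<exists>F (k::nat). F face_of polyhedral_cone A \<and> aff_dim F = int k \<and>
       h \<in> rel_interior F \<and> int k \<le> abs_det A)"
proof
  let ?H = "height (normalized_generators A) ` hilbert_basis_elements A"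
  let ?Q = "(\<lambda>m. real_of_int m / real_of_int (abs_det A)) ` {0..abs_det A}"
  have H: "?H \<subseteq> ?Q" using height_hilbert_basis_element[OF assms(1)] by blast
  hence fin: "finite ?H" by (rule finite_subset) simp
  have ne: "?H \<noteq> {}" using assms(2) by blast
  have "cone_height A = Max ?H"
    unfolding cone_height_def by (rule Greatest_equality) (use fin ne in auto)
  also have "\<dots> \<in> ?Q" using Max_in[OF fin ne] H by blast
  finally show "cone_height A \<le> 1"
    using det_nonzero[OF assms(1)] by (auto simp: abs_det_def)
next
  obtain x where x: "h = real_vec x" "\<forall>i. 0 \<le> (A *v x) $ i" "(\<Sum>i\<in>UNIV. (A *v x) $ i) \<le> abs_det A"
    by (rule hilbert_basis_element_slack_sum[OF det_nonzero[OF assms(1)] assms(2)])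
  define S where "S = {i. 0 < (A *v x) $ i}"
  have zero: "(A *v x) $ i = 0" if "i \<notin> S" for i
    using that x(2) by (simp add: S_def order.antisym)
  have slack: "real_matrix A *v h = real_vec (A *v x)" by (simp add: x(1) real_matrix_mult_real_vec)
  have "int (card S) = (\<Sum>i\<in>S. 1)" by simp
  also have "\<dots> \<le> (\<Sum>i\<in>S. (A *v x) $ i)" by (rule sum_mono) (simp add: S_def)
  also have "\<dots> \<le> (\<Sum>i\<in>UNIV. (A *v x) $ i)" by (rule sum_mono2) (simp_all add: x(2))
  also note x(3)
  finally have card: "int (card S) \<le> abs_det A" .
  have "h \<in> slack_face A S"
    using assms(2) zero by (simp add: slack_face_def hilbert_basis_elements_def slack)
  hence "h \<in> rel_interior (slack_face A S)"
    by (rule mem_rel_interior_slack_face) (simp add: slack S_def)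
  with card show "\<exists>F (k::nat). F face_of polyhedral_cone A \<and> aff_dim F = int k \<and>
       h \<in> rel_interior F \<and> int k \<le> abs_det A"
    using slack_face_face_of aff_dim_slack_face[OF assms(1)] by blast
qed

end
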